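(* Let $\mathcal A$ be a radical-dense variety. If $A$ is an absolute retract in $\mathcal A$ which is not semisimple, then $A$ has a principal unity $\epsilon$, and $\{0,\epsilon,1\}$ is a subalgebra of $A$ isomorphic to the three-element Heyting algebra $H_3$.
   Context: A residuated lattice is an algebra $\langle A,\wedge,\vee,\odot,\rightarrow,0,1\rangle$ of type $\langle2,2,2,2,0,0\rangle$ such that $\langle A,\odot,1\rangle$ is a commutative monoid, $\langle A,\vee,\wedge,0,1\rangle$ is a bounded lattice (order $\le$), and $a\odot b\le c$ iff $a\le b\rightarrow c$. Put $\neg x=x\rightarrow0$, $a^1=a$, $a^{n+1}=a^n\odot a$. An element $a$ is nilpotent if $a^n=0$ for some $n\ge1$; dense if $\neg a=0$; a unity if $\neg(a^n)$ is nilpotent for every $n\ge1$. $Ds(A)$ is the set of dense elements and $Rad(A)$ is the intersection of all maximal proper implicative filters of $A$ (equivalently, the set of unities); $A$ is semisimple iff $Rad(A)=\{1\}$. If $Rad(A)$ has a least element $\epsilon$ (so $Rad(A)=\{x:x\ge\epsilon\}$), $\epsilon$ is the principal unity of $A$. A variety $\mathcal A$ is radical-dense if it is a subvariety of the variety of residuated lattices and $Rad(A)=Ds(A)$ for every $A\in\mathcal A$. $H_3$ is the chain $0<a<1$ with $x\odot y=x\wedge y$ and $x\rightarrow y=1$ if $x\le y$, $=y$ otherwise. $A\in\mathcal A$ is an absolute retract in $\mathcal A$ if for every $B\in\mathcal A$ and injective homomorphism $i:A\to B$ there is a homomorphism $r:B\to A$ with $r\circ i=1_A$. *)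

theory Defs
  imports "HOL-Algebra.Group"
begin

text \<open>Algebras of type (2,2,2,2,0,0), with the product and the unit inherited from \<^typ>\<open>'a monoid\<close>.\<close>

record 'a rl = "'a monoid" +
  inf_op  :: "['a, 'a] \<Rightarrow> 'a"  (infixl "\<curlywedge>\<index>" 70)
  sup_op  :: "['a, 'a] \<Rightarrow> 'a"  (infixl "\<curlyvee>\<index>" 65)
  impl    :: "['a, 'a] \<Rightarrow> 'a"  (infixr "\<rightharpoonup>\<index>" 60)
  zero_el :: "'a"  ("\<zero>\<index>")

definition rl_le :: "'a rl \<Rightarrow> 'a \<Rightarrow> 'a \<Rightarrow> bool" where
  "rl_le A x y \<longleftrightarrow> x \<curlywedge>\<^bsub>A\<^esub> y = x"

definition rl_neg :: "'a rl \<Rightarrow> 'a \<Rightarrow> 'a" where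
  "rl_neg A x = x \<rightharpoonup>\<^bsub>A\<^esub> \<zero>\<^bsub>A\<^esub>"

locale residuated_lattice = comm_monoid A for A :: "'a rl" (structure) +
  assumes inf_closed: "\<lbrakk>x \<in> carrier A; y \<in> carrier A\<rbrakk> \<Longrightarrow> x \<curlywedge> y \<in> carrier A"
    and sup_closed: "\<lbrakk>x \<in> carrier A; y \<in> carrier A\<rbrakk> \<Longrightarrow> x \<curlyvee> y \<in> carrier A"
    and impl_closed: "\<lbrakk>x \<in> carrier A; y \<in> carrier A\<rbrakk> \<Longrightarrow> x \<rightharpoonup> y \<in> carrier A"
    and zero_closed: "\<zero> \<in> carrier A"
    and inf_commute: "\<lbrakk>x \<in> carrier A; y \<in> carrier A\<rbrakk> \<Longrightarrow> x \<curlywedge> y = y \<curlywedge> x"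
    and sup_commute: "\<lbrakk>x \<in> carrier A; y \<in> carrier A\<rbrakk> \<Longrightarrow> x \<curlyvee> y = y \<curlyvee> x"
    and inf_assoc: "\<lbrakk>x \<in> carrier A; y \<in> carrier A; z \<in> carrier A\<rbrakk>
                      \<Longrightarrow> (x \<curlywedge> y) \<curlywedge> z = x \<curlywedge> (y \<curlywedge> z)"
    and sup_assoc: "\<lbrakk>x \<in> carrier A; y \<in> carrier A; z \<in> carrier A\<rbrakk>
                      \<Longrightarrow> (x \<curlyvee> y) \<curlyvee> z = x \<curlyvee> (y \<curlyvee> z)"
    and inf_sup_absorb: "\<lbrakk>x \<in> carrier A; y \<in> carrier A\<rbrakk> \<Longrightarrow> x \<curlywedge> (x \<curlyvee> y) = x"
    and sup_inf_absorb: "\<lbrakk>x \<in> carrier A; y \<in> carrier A\<rbrakk> \<Longrightarrow> x \<curlyvee> (x \<curlywedge> y) = x"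
    and zero_least: "x \<in> carrier A \<Longrightarrow> rl_le A \<zero> x"
    and one_greatest: "x \<in> carrier A \<Longrightarrow> rl_le A x \<one>"
    and residuation: "\<lbrakk>x \<in> carrier A; y \<in> carrier A; z \<in> carrier A\<rbrakk>
                      \<Longrightarrow> rl_le A (x \<otimes> y) z \<longleftrightarrow> rl_le A x (y \<rightharpoonup> z)"

text \<open>Varieties are equational classes: a set \<open>E\<close> of identities in countably many variables
  determines a subvariety of the variety of residuated lattices, and every subvariety arises so.
  The constant \<open>rl_variety E\<close> is polymorphic in the type carrying the universes of its members.\<close>

datatype rl_term =
    Var nat | Zero | One
  | Inf rl_term rl_term | Sup rl_term rl_term | Mult rl_term rl_term | Impl rl_term rl_term

primrec rl_eval :: "'a rl \<Rightarrow> (nat \<Rightarrow> 'a) \<Rightarrow> rl_term \<Rightarrow> 'a" where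
  "rl_eval A v (Var n) = v n"
| "rl_eval A v Zero = \<zero>\<^bsub>A\<^esub>"
| "rl_eval A v One = \<one>\<^bsub>A\<^esub>"
| "rl_eval A v (Inf s t) = rl_eval A v s \<curlywedge>\<^bsub>A\<^esub> rl_eval A v t"
| "rl_eval A v (Sup s t) = rl_eval A v s \<curlyvee>\<^bsub>A\<^esub> rl_eval A v t"
| "rl_eval A v (Mult s t) = rl_eval A v s \<otimes>\<^bsub>A\<^esub> rl_eval A v t"
| "rl_eval A v (Impl s t) = rl_eval A v s \<rightharpoonup>\<^bsub>A\<^esub> rl_eval A v t"

definition rl_variety :: "(rl_term \<times> rl_term) set \<Rightarrow> 'a rl set" where
  "rl_variety E = {A. residuated_lattice A \<and>
     (\<forall>(s, t) \<in> E. \<forall>v. range v \<subseteq> carrier A \<longrightarrow> rl_eval A v s = rl_eval A v t)}"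

definition implicative_filter :: "'a rl \<Rightarrow> 'a set \<Rightarrow> bool" where
  "implicative_filter A F \<longleftrightarrow> F \<subseteq> carrier A \<and> \<one>\<^bsub>A\<^esub> \<in> F \<and>
     (\<forall>x \<in> carrier A. \<forall>y \<in> carrier A. x \<in> F \<and> x \<rightharpoonup>\<^bsub>A\<^esub> y \<in> F \<longrightarrow> y \<in> F)"

definition maximal_filter :: "'a rl \<Rightarrow> 'a set \<Rightarrow> bool" where
  "maximal_filter A F \<longleftrightarrow> implicative_filter A F \<and> F \<noteq> carrier A \<and>
     (\<forall>G. implicative_filter A G \<and> G \<noteq> carrier A \<and> F \<subseteq> G \<longrightarrow> G = F)"

text \<open>In the trivial algebra there is no maximal filter and the empty intersection is the carrier.\<close>

definition Rad :: "'a rl \<Rightarrow> 'a set" where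
  "Rad A = {x \<in> carrier A. \<forall>F. maximal_filter A F \<longrightarrow> x \<in> F}"

definition Ds :: "'a rl \<Rightarrow> 'a set" where
  "Ds A = {x \<in> carrier A. rl_neg A x = \<zero>\<^bsub>A\<^esub>}"

definition semisimple :: "'a rl \<Rightarrow> bool" where
  "semisimple A \<longleftrightarrow> Rad A = {\<one>\<^bsub>A\<^esub>}"

definition principal_unity :: "'a rl \<Rightarrow> 'a \<Rightarrow> bool" where
  "principal_unity A e \<longleftrightarrow> e \<in> Rad A \<and> (\<forall>x \<in> Rad A. rl_le A e x)"

definition rl_hom :: "'a rl \<Rightarrow> 'b rl \<Rightarrow> ('a \<Rightarrow> 'b) set" where
  "rl_hom A B = {h. h ` carrier A \<subseteq> carrier B \<and> h \<zero>\<^bsub>A\<^esub> = \<zero>\<^bsub>B\<^esub> \<and> h \<one>\<^bsub>A\<^esub> = \<one>\<^bsub>B\<^esub> \<and>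
     (\<forall>x \<in> carrier A. \<forall>y \<in> carrier A.
        h (x \<curlywedge>\<^bsub>A\<^esub> y) = h x \<curlywedge>\<^bsub>B\<^esub> h y \<and> h (x \<curlyvee>\<^bsub>A\<^esub> y) = h x \<curlyvee>\<^bsub>B\<^esub> h y \<and>
        h (x \<otimes>\<^bsub>A\<^esub> y) = h x \<otimes>\<^bsub>B\<^esub> h y \<and> h (x \<rightharpoonup>\<^bsub>A\<^esub> y) = h x \<rightharpoonup>\<^bsub>B\<^esub> h y)}"

definition rl_isomorphic :: "'a rl \<Rightarrow> 'b rl \<Rightarrow> bool" where
  "rl_isomorphic A B \<longleftrightarrow> (\<exists>h \<in> rl_hom A B. bij_betw h (carrier A) (carrier B))"

definition subalgebra :: "'a set \<Rightarrow> 'a rl \<Rightarrow> bool" where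
  "subalgebra S A \<longleftrightarrow> S \<subseteq> carrier A \<and> \<zero>\<^bsub>A\<^esub> \<in> S \<and> \<one>\<^bsub>A\<^esub> \<in> S \<and>
     (\<forall>x \<in> S. \<forall>y \<in> S. x \<curlywedge>\<^bsub>A\<^esub> y \<in> S \<and> x \<curlyvee>\<^bsub>A\<^esub> y \<in> S \<and> x \<otimes>\<^bsub>A\<^esub> y \<in> S \<and> x \<rightharpoonup>\<^bsub>A\<^esub> y \<in> S)"

text \<open>The chain \<open>0 < a < 1\<close> is encoded as \<open>0 < 1 < 2\<close> in the natural numbers; its unit is \<open>2\<close>.\<close>

definition H3 :: "nat rl" where
  "H3 = \<lparr>carrier = {0, 1, 2}, mult = min, one = 2, inf_op = min, sup_op = max,
         impl = (\<lambda>x y. if x \<le> y then 2 else y), zero_el = 0\<rparr>"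

text \<open>HOL formulas cannot quantify over types, so a property that speaks of all members of a
  variety takes as an extra argument the type \<open>'u\<close> in which their universes lie.\<close>

definition radical_dense :: "'u itself \<Rightarrow> (rl_term \<times> rl_term) set \<Rightarrow> bool" where
  "radical_dense TYPE('u) E \<longleftrightarrow> (\<forall>B \<in> (rl_variety E :: 'u rl set). Rad B = Ds B)"

definition absolute_retract :: "'u itself \<Rightarrow> (rl_term \<times> rl_term) set \<Rightarrow> 'a rl \<Rightarrow> bool" where
  "absolute_retract TYPE('u) E A \<longleftrightarrow> A \<in> rl_variety E \<and>
     (\<forall>B \<in> (rl_variety E :: 'u rl set). \<forall>i \<in> rl_hom A B. inj_on i (carrier A) \<longrightarrow>
        (\<exists>r \<in> rl_hom B A. \<forall>x \<in> carrier A. r (i x) = x))"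

text \<open>The range of the algebras \<open>B\<close> for an algebra \<open>A\<close> with universe in \<open>'a\<close>: with \<open>k\<close> the
  cardinality of \<open>'a + nat\<close>, it holds copies of all algebras of cardinality up to \<open>2 ^ (k ^ k)\<close>,
  in particular of \<open>A\<close>, of its power \<open>A ^ A\<close> and of all quotients of that power. Hypotheses over
  this type follow from the unrestricted ones. For \<open>radical_dense\<close> the converse holds as well:
  a radical element that is not dense is still one in the subalgebra it generates, which is
  countable, and the type is infinite.\<close>

type_synonym 'a univ = "('a + nat \<Rightarrow> 'a + nat) set"

end

theory Submission
  imports Defs
begin

text \<open>The dense elements of \<open>A\<close> are closed under products, hence directed downwards. In the
  power of \<open>A\<close> indexed by the dense elements, reduced by the filter of their lower sections, the
  class of the identity is dense and lies below the diagonal image of every dense element of \<open>A\<close>.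
  A retraction onto the diagonal sends it to the least dense element of \<open>A\<close>, which is idempotent
  because its square is dense too.\<close>

section \<open>Order and density in residuated lattices\<close>

context residuated_lattice
begin

lemma le_refl: "x \<in> carrier A \<Longrightarrow> rl_le A x x"
  unfolding rl_le_def by (metis inf_sup_absorb sup_inf_absorb inf_closed)

lemma le_antisym:
  "\<lbrakk>rl_le A x y; rl_le A y x; x \<in> carrier A; y \<in> carrier A\<rbrakk> \<Longrightarrow> x = y"
  unfolding rl_le_def by (metis inf_commute)

lemma le_trans:
  "\<lbrakk>rl_le A x y; rl_le A y z; x \<in> carrier A; y \<in> carrier A; z \<in> carrier A\<rbrakk> \<Longrightarrow> rl_le A x z"
  unfolding rl_le_def by (metis inf_assoc)

lemma le_zero_iff: "x \<in> carrier A \<Longrightarrow> rl_le A x \<zero> \<longleftrightarrow> x = \<zero>"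
  using le_antisym le_refl zero_closed zero_least by blast

lemma one_le_iff: "x \<in> carrier A \<Longrightarrow> rl_le A \<one> x \<longleftrightarrow> x = \<one>"
  using le_antisym le_refl one_closed one_greatest by blast

lemma impl_eq_one_iff:
  assumes "x \<in> carrier A" "y \<in> carrier A"
  shows "x \<rightharpoonup> y = \<one> \<longleftrightarrow> rl_le A x y"
  using assms residuation[of \<one> x y] by (simp add: one_le_iff impl_closed)

lemma one_impl:
  assumes "x \<in> carrier A"
  shows "\<one> \<rightharpoonup> x = x"
proof (rule le_antisym)
  have c: "\<one> \<rightharpoonup> x \<in> carrier A"
    using assms by (simp add: impl_closed)
  show "rl_le A (\<one> \<rightharpoonup> x) x"
    using residuation[of "\<one> \<rightharpoonup> x" \<one> x] assms c by (simp add: le_refl)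
  show "rl_le A x (\<one> \<rightharpoonup> x)"
    using residuation[of x \<one> x] assms by (simp add: le_refl)
qed (use assms in \<open>simp_all add: impl_closed\<close>)

lemma sup_eq_of_le:
  "\<lbrakk>rl_le A x y; x \<in> carrier A; y \<in> carrier A\<rbrakk> \<Longrightarrow> x \<curlyvee> y = y"
  unfolding rl_le_def by (metis inf_commute sup_commute sup_inf_absorb)

lemma mult_le_right:
  assumes "x \<in> carrier A" "y \<in> carrier A"
  shows "rl_le A (x \<otimes> y) y"
  using assms residuation[of x y y] impl_eq_one_iff[of y y] by (simp add: le_refl one_greatest)

lemma mult_le_left:
  assumes "x \<in> carrier A" "y \<in> carrier A"
  shows "rl_le A (x \<otimes> y) x"
  using mult_le_right[of y x] assms by (simp add: m_comm)

lemma zero_mult: "x \<in> carrier A \<Longrightarrow> \<zero> \<otimes> x = \<zero>"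
  using mult_le_left[of \<zero> x] by (simp add: le_zero_iff zero_closed)

lemma one_dense: "\<one> \<in> Ds A"
  by (simp add: Ds_def rl_neg_def one_impl zero_closed)

text \<open>Residuating twice: if \<open>t\<close> is the negation of \<open>x \<otimes> y\<close>,
  then \<open>t \<otimes> x\<close> lies below the negation of \<open>y\<close>, which is
  \<open>\<zero>\<close>, and so \<open>t\<close> lies below the negation of \<open>x\<close>, again
  \<open>\<zero>\<close>.\<close>

lemma Ds_mult:
  assumes "x \<in> Ds A" "y \<in> Ds A"
  shows "x \<otimes> y \<in> Ds A"
proof -
  have c: "x \<in> carrier A" "y \<in> carrier A" and n: "x \<rightharpoonup> \<zero> = \<zero>" "y \<rightharpoonup> \<zero> = \<zero>"
    using assms by (auto simp: Ds_def rl_neg_def)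
  define t where "t = (x \<otimes> y) \<rightharpoonup> \<zero>"
  have t: "t \<in> carrier A"
    using c by (simp add: t_def impl_closed zero_closed)
  have "rl_le A (t \<otimes> (x \<otimes> y)) \<zero>"
    using residuation[of t "x \<otimes> y" \<zero>] c t le_refl[OF t] by (simp add: zero_closed t_def)
  hence "rl_le A ((t \<otimes> x) \<otimes> y) \<zero>"
    using c t by (simp add: m_assoc)
  hence "rl_le A (t \<otimes> x) \<zero>"
    using residuation[of "t \<otimes> x" y \<zero>] c t n by (simp add: zero_closed)
  hence "rl_le A t \<zero>"
    using residuation[of t x \<zero>] c t n by (simp add: zero_closed)
  thus ?thesis
    using c t by (simp add: Ds_def rl_neg_def t_def le_zero_iff)
qed

lemma least_dense_idem:
  assumes e: "e \<in> Ds A" and least: "\<And>x. x \<in> Ds A \<Longrightarrow> rl_le A e x"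
  shows "e \<otimes> e = e"
proof -
  have c: "e \<in> carrier A"
    using e by (simp add: Ds_def)
  show ?thesis
    using le_antisym[OF mult_le_left least] c e Ds_mult by simp
qed

end

section \<open>Homomorphisms and the three-element subalgebra\<close>

text \<open>Density is an equation between constant terms and \<open>x\<close>, so homomorphisms
  preserve it; this later carries a dense class of the reduced power back into
  \<open>A\<close>.\<close>

lemma rl_hom_Ds:
  assumes "h \<in> rl_hom A B" "x \<in> Ds A" "\<zero>\<^bsub>A\<^esub> \<in> carrier A"
  shows "h x \<in> Ds B"
proof -
  have "h (x \<rightharpoonup>\<^bsub>A\<^esub> \<zero>\<^bsub>A\<^esub>) = h x \<rightharpoonup>\<^bsub>B\<^esub> h \<zero>\<^bsub>A\<^esub>"
    using assms unfolding rl_hom_def Ds_def by blast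
  thus ?thesis
    using assms by (auto simp: rl_hom_def Ds_def rl_neg_def)
qed

lemma rl_hom_le:
  assumes "h \<in> rl_hom A B" "rl_le A x y" "x \<in> carrier A" "y \<in> carrier A"
  shows "rl_le B (h x) (h y)"
proof -
  have "h (x \<curlywedge>\<^bsub>A\<^esub> y) = h x \<curlywedge>\<^bsub>B\<^esub> h y"
    using assms unfolding rl_hom_def by blast
  thus ?thesis
    using assms by (simp add: rl_le_def)
qed

text \<open>Order, unit law and residuation settle every entry of the operation tables on the chain
  except \<open>e \<otimes> e\<close> and \<open>e \<rightharpoonup> \<zero>\<close>, and these two
  are supplied by \<open>idem\<close> and \<open>neg\<close>.\<close>

lemma (in residuated_lattice) rl_isomorphic_H3:
  assumes e: "e \<in> carrier A" and ne: "e \<noteq> \<zero>" "e \<noteq> \<one>" "\<zero> \<noteq> \<one>"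
    and idem: "e \<otimes> e = e" and neg: "e \<rightharpoonup> \<zero> = \<zero>"
  shows "subalgebra {\<zero>, e, \<one>} A" "rl_isomorphic (A\<lparr>carrier := {\<zero>, e, \<one>}\<rparr>) H3"
proof -
  note z = zero_closed
  have le: "rl_le A \<zero> e" "rl_le A \<zero> \<one>" "rl_le A e \<one>"
      "rl_le A \<zero> \<zero>" "rl_le A e e" "rl_le A \<one> \<one>"
    using e z by (simp_all add: zero_least one_greatest le_refl)
  have i: "\<zero> \<curlywedge> \<zero> = \<zero>" "\<zero> \<curlywedge> e = \<zero>" "\<zero> \<curlywedge> \<one> = \<zero>" "e \<curlywedge> \<zero> = \<zero>" "e \<curlywedge> e = e"
      "e \<curlywedge> \<one> = e" "\<one> \<curlywedge> \<zero> = \<zero>" "\<one> \<curlywedge> e = e" "\<one> \<curlywedge> \<one> = \<one>"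
    using le e z inf_commute one_closed unfolding rl_le_def by metis+
  have s: "\<zero> \<curlyvee> \<zero> = \<zero>" "\<zero> \<curlyvee> e = e" "\<zero> \<curlyvee> \<one> = \<one>" "e \<curlyvee> \<zero> = e" "e \<curlyvee> e = e"
      "e \<curlyvee> \<one> = \<one>" "\<one> \<curlyvee> \<zero> = \<one>" "\<one> \<curlyvee> e = \<one>" "\<one> \<curlyvee> \<one> = \<one>"
    using le e z sup_commute sup_eq_of_le one_closed by metis+
  have m: "\<zero> \<otimes> \<zero> = \<zero>" "\<zero> \<otimes> e = \<zero>" "\<zero> \<otimes> \<one> = \<zero>" "e \<otimes> \<zero> = \<zero>" "\<one> \<otimes> \<zero> = \<zero>"
      "e \<otimes> \<one> = e" "\<one> \<otimes> e = e"
    using e z zero_mult[OF e] by (simp_all add: zero_mult m_comm)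
  have p: "\<zero> \<rightharpoonup> \<zero> = \<one>" "\<zero> \<rightharpoonup> e = \<one>" "\<zero> \<rightharpoonup> \<one> = \<one>" "e \<rightharpoonup> e = \<one>" "e \<rightharpoonup> \<one> = \<one>"
      "\<one> \<rightharpoonup> \<one> = \<one>" "\<one> \<rightharpoonup> e = e" "\<one> \<rightharpoonup> \<zero> = \<zero>"
    using le e z by (simp_all add: impl_eq_one_iff one_impl)
  note ops = i s m p idem neg
  show "subalgebra {\<zero>, e, \<one>} A"
    using e z by (auto simp: subalgebra_def ops)
  \<comment> \<open>The values follow the encoding of \<open>H3\<close>, whose unit is 2; by
    \<open>ne\<close> the three elements fall into three different branches.\<close>
  define h where "h x = (if x = \<zero> then 0 else if x = e then 1 else 2 :: nat)" for x
  have h: "h \<zero> = 0" "h e = 1" "h \<one> = 2"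
    using ne by (auto simp: h_def)
  have "h \<in> rl_hom (A\<lparr>carrier := {\<zero>, e, \<one>}\<rparr>) H3"
    by (auto simp: rl_hom_def H3_def ops h)
  moreover have "bij_betw h (carrier (A\<lparr>carrier := {\<zero>, e, \<one>}\<rparr>)) (carrier H3)"
    using h by (auto simp: bij_betw_def inj_on_def H3_def)
  ultimately show "rl_isomorphic (A\<lparr>carrier := {\<zero>, e, \<one>}\<rparr>) H3"
    unfolding rl_isomorphic_def by blast
qed

section \<open>Invariance of the radical under isomorphism\<close>

text \<open>Filters and dense elements mention only the constants and implication, so closure of
  \<open>A\<close> under these accompanies the bijective homomorphism. The two universes may have
  different types.\<close>

locale rl_iso =
  fixes A :: "'a rl" and B :: "'b rl" and h :: "'a \<Rightarrow> 'b"
  assumes hom: "h \<in> rl_hom A B"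
    and bij: "bij_betw h (carrier A) (carrier B)"
    and one_closed: "\<one>\<^bsub>A\<^esub> \<in> carrier A"
    and zero_closed: "\<zero>\<^bsub>A\<^esub> \<in> carrier A"
    and impl_closed: "\<lbrakk>x \<in> carrier A; y \<in> carrier A\<rbrakk> \<Longrightarrow> x \<rightharpoonup>\<^bsub>A\<^esub> y \<in> carrier A"
begin

lemma hom_one: "h \<one>\<^bsub>A\<^esub> = \<one>\<^bsub>B\<^esub>" and hom_zero: "h \<zero>\<^bsub>A\<^esub> = \<zero>\<^bsub>B\<^esub>"
  and hom_impl: "\<lbrakk>x \<in> carrier A; y \<in> carrier A\<rbrakk> \<Longrightarrow> h (x \<rightharpoonup>\<^bsub>A\<^esub> y) = h x \<rightharpoonup>\<^bsub>B\<^esub> h y"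
  using hom unfolding rl_hom_def by blast+

lemma inj_h: "inj_on h (carrier A)" and image_h: "h ` carrier A = carrier B"
  using bij by (auto simp: bij_betw_def)

lemma implicative_filter_image_iff:
  assumes "F \<subseteq> carrier A"
  shows "implicative_filter B (h ` F) \<longleftrightarrow> implicative_filter A F"
proof -
  have mem: "h x \<in> h ` F \<longleftrightarrow> x \<in> F" if "x \<in> carrier A" for x
    using inj_on_image_mem_iff[OF inj_h that assms] .
  have "h ` F \<subseteq> h ` carrier A"
    using assms by blast
  moreover have "\<one>\<^bsub>B\<^esub> \<in> h ` F \<longleftrightarrow> \<one>\<^bsub>A\<^esub> \<in> F"
    using mem[OF one_closed] by (simp add: hom_one)
  ultimately show ?thesis
    \<comment> \<open>Reading \<open>image_h\<close> backwards turns quantifiers over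
      \<open>carrier B\<close> into quantifiers over \<open>carrier A\<close>; then
      \<open>mem\<close> transfers modus ponens in both directions.\<close>
    using assms by (simp add: implicative_filter_def flip: image_h)
      (simp add: mem hom_impl[symmetric] impl_closed cong: ball_cong)
qed

lemma image_eq_carrier_iff:
  assumes "F \<subseteq> carrier A"
  shows "h ` F = carrier B \<longleftrightarrow> F = carrier A"
  using inj_on_image_eq_iff[OF inj_h assms subset_refl] by (simp add: image_h)

lemma maximal_filter_image:
  assumes "maximal_filter A F"
  shows "maximal_filter B (h ` F)"
proof -
  have F: "implicative_filter A F" "F \<noteq> carrier A" "F \<subseteq> carrier A"
    using assms unfolding maximal_filter_def implicative_filter_def by blast+
  have "G = h ` F"
    if G: "implicative_filter B G" "G \<noteq> carrier B" "h ` F \<subseteq> G" for G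
  proof -
    obtain G' where G': "G' \<subseteq> carrier A" "G = h ` G'"
      using G(1) image_h unfolding implicative_filter_def by (metis subset_image_iff)
    have "implicative_filter A G'" "G' \<noteq> carrier A"
      using G G' implicative_filter_image_iff image_eq_carrier_iff by auto
    moreover have "F \<subseteq> G'"
      using G(3) F(3) G' inj_on_image_mem_iff[OF inj_h _ G'(1)] by blast
    ultimately show ?thesis
      using assms G' unfolding maximal_filter_def by blast
  qed
  thus ?thesis
    using F implicative_filter_image_iff image_eq_carrier_iff
    unfolding maximal_filter_def by blast
qed

lemma maximal_filter_imageD:
  assumes F: "F \<subseteq> carrier A" and "maximal_filter B (h ` F)"
  shows "maximal_filter A F"
proof -
  have max: "implicative_filter B (h ` F)" "h ` F \<noteq> carrier B"
      "\<And>G. \<lbrakk>implicative_filter B G; G \<noteq> carrier B; h ` F \<subseteq> G\<rbrakk> \<Longrightarrow> G = h ` F"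
    using assms(2) unfolding maximal_filter_def by blast+
  have "G = F" if G: "implicative_filter A G" "G \<noteq> carrier A" "F \<subseteq> G" for G
  proof -
    have G': "G \<subseteq> carrier A"
      using G(1) by (simp add: implicative_filter_def)
    have "h ` G = h ` F"
      using max(3)[of "h ` G"] G implicative_filter_image_iff[OF G'] image_eq_carrier_iff[OF G']
      by blast
    thus ?thesis
      using inj_on_image_eq_iff[OF inj_h G' F] by simp
  qed
  thus ?thesis
    using max implicative_filter_image_iff[OF F] image_eq_carrier_iff[OF F]
    unfolding maximal_filter_def by blast
qed

text \<open>Taking images matches the maximal filters of \<open>A\<close> with those of
  \<open>B\<close>, so their intersections correspond, even when there are none.\<close>

lemma Rad_iff:
  assumes x: "x \<in> carrier A"
  shows "h x \<in> Rad B \<longleftrightarrow> x \<in> Rad A"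
proof
  assume R: "h x \<in> Rad B"
  have "x \<in> F" if F: "maximal_filter A F" for F
  proof -
    have "F \<subseteq> carrier A"
      using F by (simp add: maximal_filter_def implicative_filter_def)
    moreover have "h x \<in> h ` F"
      using R maximal_filter_image[OF F] by (simp add: Rad_def)
    ultimately show ?thesis
      using inj_on_image_mem_iff[OF inj_h x] by blast
  qed
  thus "x \<in> Rad A"
    using x by (simp add: Rad_def)
next
  assume R: "x \<in> Rad A"
  have "h x \<in> F" if F: "maximal_filter B F" for F
  proof -
    have "F \<subseteq> h ` carrier A"
      using F by (simp add: maximal_filter_def implicative_filter_def image_h)
    then obtain F' where F': "F' \<subseteq> carrier A" "F = h ` F'"
      by (metis subset_image_iff)
    thus ?thesis
      using R F maximal_filter_imageD[of F'] by (simp add: Rad_def)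
  qed
  thus "h x \<in> Rad B"
    using x image_h by (auto simp: Rad_def)
qed

lemma Ds_iff:
  assumes "x \<in> carrier A"
  shows "h x \<in> Ds B \<longleftrightarrow> x \<in> Ds A"
proof -
  have "h x \<rightharpoonup>\<^bsub>B\<^esub> \<zero>\<^bsub>B\<^esub> = \<zero>\<^bsub>B\<^esub> \<longleftrightarrow> h (x \<rightharpoonup>\<^bsub>A\<^esub> \<zero>\<^bsub>A\<^esub>) = h \<zero>\<^bsub>A\<^esub>"
    using assms by (simp add: hom_impl hom_zero zero_closed)
  also have "\<dots> \<longleftrightarrow> x \<rightharpoonup>\<^bsub>A\<^esub> \<zero>\<^bsub>A\<^esub> = \<zero>\<^bsub>A\<^esub>"
    using assms by (intro inj_on_eq_iff[OF inj_h]) (auto simp: zero_closed impl_closed)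
  finally show ?thesis
    using assms image_h by (auto simp: Ds_def rl_neg_def)
qed

lemma Rad_eq_DsD:
  assumes "Rad B = Ds B"
  shows "Rad A = Ds A"
proof (rule Set.set_eqI)
  fix x
  show "x \<in> Rad A \<longleftrightarrow> x \<in> Ds A"
  proof (cases "x \<in> carrier A")
    case True
    thus ?thesis
      using Rad_iff Ds_iff assms by blast
  qed (simp add: Rad_def Ds_def)
qed

end

section \<open>Reduced powers\<close>

text \<open>The index set is a whole type, so families are plain total functions and equality of
  families is equality of functions.\<close>

definition power_carrier :: "'a rl \<Rightarrow> ('i \<Rightarrow> 'a) set" where
  "power_carrier A = {f. \<forall>i. f i \<in> carrier A}"

text \<open>The quotient map \<open>q\<close> is a parameter, so that the type of its values can be chosen freely.\<close>

definition quotient_power :: "(('i \<Rightarrow> 'a) \<Rightarrow> 'b) \<Rightarrow> 'a rl \<Rightarrow> 'b rl" where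
  "quotient_power q A = (let rep = inv_into (power_carrier A) q in
     \<lparr>carrier = q ` power_carrier A,
      mult = (\<lambda>x y. q (\<lambda>i. rep x i \<otimes>\<^bsub>A\<^esub> rep y i)),
      one = q (\<lambda>_. \<one>\<^bsub>A\<^esub>),
      inf_op = (\<lambda>x y. q (\<lambda>i. rep x i \<curlywedge>\<^bsub>A\<^esub> rep y i)),
      sup_op = (\<lambda>x y. q (\<lambda>i. rep x i \<curlyvee>\<^bsub>A\<^esub> rep y i)),
      impl = (\<lambda>x y. q (\<lambda>i. rep x i \<rightharpoonup>\<^bsub>A\<^esub> rep y i)),
      zero_el = q (\<lambda>_. \<zero>\<^bsub>A\<^esub>)\<rparr>)"

text \<open>The kernel of \<open>q\<close> on the power is agreement on a set of the filter
  \<open>F\<close>, which makes its image the power of \<open>A\<close> reduced by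
  \<open>F\<close>.\<close>

locale reduced_power = residuated_lattice A for A :: "'a rl" (structure) +
  fixes F :: "'i filter" and q :: "('i \<Rightarrow> 'a) \<Rightarrow> 'b"
  assumes q_eq_iff: "\<lbrakk>f \<in> power_carrier A; g \<in> power_carrier A\<rbrakk>
    \<Longrightarrow> q f = q g \<longleftrightarrow> eventually (\<lambda>i. f i = g i) F"
begin

abbreviation "P \<equiv> power_carrier A :: ('i \<Rightarrow> 'a) set"
abbreviation "B \<equiv> quotient_power q A"

lemma rep_mem: "f \<in> P \<Longrightarrow> inv_into P q (q f) \<in> P"
  by (simp add: inv_into_into)

lemma rep_eventually: "f \<in> P \<Longrightarrow> eventually (\<lambda>i. inv_into P q (q f) i = f i) F"
  using q_eq_iff[OF rep_mem[of f], of f] by (simp add: f_inv_into_f)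

lemma PD: "f \<in> P \<Longrightarrow> f i \<in> carrier A"
  by (simp add: power_carrier_def)

text \<open>This is well-definedness of the operations: chosen representatives agree with
  \<open>f\<close> and with \<open>g\<close> eventually, hence with both at once.\<close>

lemma q_pointwise:
  assumes f: "f \<in> P" and g: "g \<in> P"
    and cl: "\<And>x y. \<lbrakk>x \<in> carrier A; y \<in> carrier A\<rbrakk> \<Longrightarrow> op x y \<in> carrier A"
  shows "q (\<lambda>i. op (inv_into P q (q f) i) (inv_into P q (q g) i)) = q (\<lambda>i. op (f i) (g i))"
proof (subst q_eq_iff)
  show "eventually (\<lambda>i. op (inv_into P q (q f) i) (inv_into P q (q g) i) = op (f i) (g i)) F"
    using rep_eventually[OF f] rep_eventually[OF g] by eventually_elim simp
qed (use rep_mem[OF f] rep_mem[OF g] f g cl in \<open>auto simp: power_carrier_def\<close>)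

lemma carrier_B: "carrier B = q ` P"
  by (simp add: quotient_power_def Let_def)

lemma one_B: "\<one>\<^bsub>B\<^esub> = q (\<lambda>_. \<one>)" and zero_B: "\<zero>\<^bsub>B\<^esub> = q (\<lambda>_. \<zero>)"
  by (simp_all add: quotient_power_def Let_def)

lemma ops_B:
  assumes "f \<in> P" "g \<in> P"
  shows "q f \<otimes>\<^bsub>B\<^esub> q g = q (\<lambda>i. f i \<otimes> g i)"
    and "q f \<curlywedge>\<^bsub>B\<^esub> q g = q (\<lambda>i. f i \<curlywedge> g i)"
    and "q f \<curlyvee>\<^bsub>B\<^esub> q g = q (\<lambda>i. f i \<curlyvee> g i)"
    and "q f \<rightharpoonup>\<^bsub>B\<^esub> q g = q (\<lambda>i. f i \<rightharpoonup> g i)"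
  using assms
  by (simp_all add: quotient_power_def Let_def q_pointwise inf_closed sup_closed impl_closed)

lemma P_closed:
  "(\<lambda>_. \<one>) \<in> P" "(\<lambda>_. \<zero>) \<in> P"
  "\<lbrakk>f \<in> P; g \<in> P\<rbrakk> \<Longrightarrow> (\<lambda>i. f i \<otimes> g i) \<in> P"
  "\<lbrakk>f \<in> P; g \<in> P\<rbrakk> \<Longrightarrow> (\<lambda>i. f i \<curlywedge> g i) \<in> P"
  "\<lbrakk>f \<in> P; g \<in> P\<rbrakk> \<Longrightarrow> (\<lambda>i. f i \<curlyvee> g i) \<in> P"
  "\<lbrakk>f \<in> P; g \<in> P\<rbrakk> \<Longrightarrow> (\<lambda>i. f i \<rightharpoonup> g i) \<in> P"
  by (auto simp: power_carrier_def zero_closed inf_closed sup_closed impl_closed)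

lemma le_B:
  assumes "f \<in> P" "g \<in> P"
  shows "rl_le B (q f) (q g) \<longleftrightarrow> eventually (\<lambda>i. rl_le A (f i) (g i)) F"
  using assms by (simp add: rl_le_def ops_B q_eq_iff P_closed)

text \<open>The lattice and monoid laws hold index by index. By \<open>le_B\<close> both sides of
  residuation are statements about eventually all indices, equivalent at each single index in
  \<open>A\<close>.\<close>

lemma residuated_lattice_B: "residuated_lattice B"
proof -
  note B = carrier_B one_B zero_B ops_B P_closed PD
  show ?thesis
  proof unfold_locales
    fix x y z assume "x \<in> carrier B" "y \<in> carrier B" "z \<in> carrier B"
    then obtain f g h where "x = q f" "y = q g" "z = q h" "f \<in> P" "g \<in> P" "h \<in> P"
      by (auto simp: carrier_B)
    thus "rl_le B (x \<otimes>\<^bsub>B\<^esub> y) z \<longleftrightarrow> rl_le B x (y \<rightharpoonup>\<^bsub>B\<^esub> z)"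
      by (simp add: B le_B residuation)
  next
    fix x y assume "x \<in> carrier B" "y \<in> carrier B"
    then obtain f g where "x = q f" "y = q g" "f \<in> P" "g \<in> P"
      by (auto simp: carrier_B)
    thus "x \<curlywedge>\<^bsub>B\<^esub> (x \<curlyvee>\<^bsub>B\<^esub> y) = x" "x \<curlyvee>\<^bsub>B\<^esub> (x \<curlywedge>\<^bsub>B\<^esub> y) = x"
      by (simp_all add: B inf_sup_absorb sup_inf_absorb)
  qed (auto simp: B le_B m_assoc inf_assoc sup_assoc zero_least one_greatest
      intro!: arg_cong[where f = q] ext m_comm inf_commute sup_commute)
qed

text \<open>The membership conjunct keeps the induction going, since \<open>ops_B\<close> applies
  only to families in the power.\<close>

lemma rl_eval_B:
  assumes "\<And>n. w n \<in> P"
  shows "rl_eval B (\<lambda>n. q (w n)) t = q (\<lambda>i. rl_eval A (\<lambda>n. w n i) t)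
    \<and> (\<lambda>i. rl_eval A (\<lambda>n. w n i) t) \<in> P"
  using assms by (induction t) (simp_all add: one_B zero_B ops_B P_closed)

lemma variety_B:
  assumes "A \<in> rl_variety E"
  shows "B \<in> rl_variety E"
proof -
  have "rl_eval B v s = rl_eval B v t" if st: "(s, t) \<in> E" and v: "range v \<subseteq> carrier B" for s t v
  proof -
    have A_eq: "rl_eval A u s = rl_eval A u t" if "range u \<subseteq> carrier A" for u
      using assms st that by (auto simp: rl_variety_def)
    \<comment> \<open>A valuation in the quotient is lifted to representatives, so that the identity
      can be used in \<open>A\<close> at every index.\<close>
    define w where "w n = inv_into P q (v n)" for n
    have w: "w n \<in> P" "q (w n) = v n" for n
      using v by (auto simp: w_def carrier_B inv_into_into f_inv_into_f subset_iff)
    have "rl_eval A (\<lambda>n. w n i) s = rl_eval A (\<lambda>n. w n i) t" for i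
    proof (rule A_eq)
      show "range (\<lambda>n. w n i) \<subseteq> carrier A"
        using PD[OF w(1)] by blast
    qed
    thus ?thesis
      using rl_eval_B[of w s] rl_eval_B[of w t] w by simp
  qed
  thus ?thesis
    using residuated_lattice_B by (auto simp: rl_variety_def)
qed

lemma diagonal_P: "x \<in> carrier A \<Longrightarrow> (\<lambda>_. x) \<in> P"
  by (simp add: power_carrier_def)

lemma diagonal_hom: "(\<lambda>x. q (\<lambda>_. x)) \<in> rl_hom A B"
  by (auto simp: rl_hom_def carrier_B one_B zero_B ops_B diagonal_P)

text \<open>Two constant families agree everywhere or nowhere, and a proper filter excludes
  agreement on the empty set.\<close>

lemma diagonal_inj:
  assumes "F \<noteq> bot"
  shows "inj_on (\<lambda>x. q (\<lambda>_. x)) (carrier A)"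
  using assms by (auto simp: inj_on_def q_eq_iff diagonal_P)

end

text \<open>The classes of a reduced power of \<open>A\<close> with index type \<open>'a\<close>, as elements of \<open>'a univ\<close>:
  \<open>map_sum g id\<close> stands for the function \<open>g\<close>.\<close>

definition reduced_class :: "'a rl \<Rightarrow> 'a filter \<Rightarrow> ('a \<Rightarrow> 'a) \<Rightarrow> 'a univ" where
  "reduced_class A F f =
     (\<lambda>g. map_sum g id) ` {g \<in> power_carrier A. eventually (\<lambda>i. f i = g i) F}"

text \<open>The left summand recovers \<open>g\<close>, so coding functions in
  \<open>'a univ\<close> identifies no two classes.\<close>

lemma inj_map_sum_id: "inj (\<lambda>g. map_sum g id)"
proof (rule injI, rule ext)
  fix g h :: "'a \<Rightarrow> 'b" and x
  assume "map_sum g (id :: 'c \<Rightarrow> 'c) = map_sum h id"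
  from fun_cong[OF this, of "Inl x"] show "g x = h x" by simp
qed

lemma reduced_power_class:
  assumes "residuated_lattice A"
  shows "reduced_power A F (reduced_class A F)"
proof -
  interpret residuated_lattice A by fact
  show ?thesis
  proof unfold_locales
    fix f g :: "'a \<Rightarrow> 'a"
    assume fg: "f \<in> power_carrier A" "g \<in> power_carrier A"
    have "reduced_class A F f = reduced_class A F g \<longleftrightarrow>
      {k \<in> power_carrier A. eventually (\<lambda>i. f i = k i) F} =
      {k \<in> power_carrier A. eventually (\<lambda>i. g i = k i) F}"
      unfolding reduced_class_def by (rule inj_image_eq_iff[OF inj_map_sum_id])
    also have "\<dots> \<longleftrightarrow> eventually (\<lambda>i. f i = g i) F"
    proof
      assume "eventually (\<lambda>i. f i = g i) F"
      hence "eventually (\<lambda>i. f i = k i) F \<longleftrightarrow> eventually (\<lambda>i. g i = k i) F" for k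
        by (rule eventually_subst[OF eventually_mono]) simp
      thus "{k \<in> power_carrier A. eventually (\<lambda>i. f i = k i) F} =
          {k \<in> power_carrier A. eventually (\<lambda>i. g i = k i) F}"
        by blast
    next
      assume "{k \<in> power_carrier A. eventually (\<lambda>i. f i = k i) F} =
          {k \<in> power_carrier A. eventually (\<lambda>i. g i = k i) F}"
      \<comment> \<open>Every family lies in its own class; equality of the classes then puts
        \<open>g\<close> into that of \<open>f\<close>.\<close>
      moreover have "g \<in> {k \<in> power_carrier A. eventually (\<lambda>i. g i = k i) F}"
        using fg by simp
      ultimately show "eventually (\<lambda>i. f i = g i) F"
        by blast
    qed
    finally show "reduced_class A F f = reduced_class A F g \<longleftrightarrow>
      eventually (\<lambda>i. f i = g i) F" .
  qed
qed

text \<open>Radical density is assumed for algebras over \<open>'a univ\<close> only. It reaches \<open>A\<close> through the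
  reduced power modulo a principal ultrafilter, which is a copy of \<open>A\<close>.\<close>

lemma radical_dense_Rad_eq_Ds:
  fixes A :: "'a rl"
  assumes "radical_dense TYPE('a univ) E" "A \<in> rl_variety E"
  shows "Rad A = Ds A"
proof -
  define F :: "'a filter" where "F = principal {undefined}"
  define q where "q = reduced_class A F"
  have A: "residuated_lattice A"
    using assms(2) by (simp add: rl_variety_def)
  interpret reduced_power A F q
    unfolding q_def using A by (rule reduced_power_class)
  have "q f \<in> (\<lambda>x. q (\<lambda>_. x)) ` carrier A" if f: "f \<in> P" for f
  proof -
    \<comment> \<open>Modulo the principal filter at \<open>undefined\<close> a family is determined
      by its value there, so the diagonal is onto.\<close>
    have "q f = q (\<lambda>_. f undefined)"
      using q_eq_iff[OF f diagonal_P[OF PD[OF f]]] by (simp add: F_def eventually_principal)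
    thus ?thesis
      using PD[OF f] by blast
  qed
  hence "(\<lambda>x. q (\<lambda>_. x)) ` carrier A = carrier B"
    by (auto simp: carrier_B diagonal_P)
  moreover have "F \<noteq> bot"
    by (simp add: F_def principal_eq_bot_iff)
  ultimately interpret rl_iso A B "\<lambda>x. q (\<lambda>_. x)"
    by unfold_locales
      (simp_all add: diagonal_hom bij_betw_def diagonal_inj zero_closed impl_closed)
  have "Rad B = Ds B"
    using assms(1) variety_B[OF assms(2)] by (simp add: radical_dense_def)
  thus ?thesis
    by (rule Rad_eq_DsD)
qed

section \<open>The least dense element\<close>

text \<open>The index type is all of \<open>'a\<close>, but every generator consists of dense
  elements, so the other indices are negligible.\<close>

definition lower_sections :: "'a rl \<Rightarrow> 'a filter" where
  "lower_sections A = (INF u\<in>Ds A. principal {d \<in> Ds A. rl_le A d u})"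

text \<open>The lower sections form a filter base: the section of \<open>u \<otimes> v\<close> is
  contained in those of \<open>u\<close> and \<open>v\<close>.\<close>

lemma (in residuated_lattice) eventually_lower_sections:
  "eventually Q (lower_sections A) \<longleftrightarrow> (\<exists>u\<in>Ds A. \<forall>d\<in>Ds A. rl_le A d u \<longrightarrow> Q d)"
proof -
  have "eventually Q (lower_sections A) \<longleftrightarrow>
    (\<exists>u\<in>Ds A. eventually Q (principal {d \<in> Ds A. rl_le A d u}))"
    unfolding lower_sections_def
  proof (rule eventually_INF_base)
    show "Ds A \<noteq> {}"
      using one_dense by blast
    fix u v assume uv: "u \<in> Ds A" "v \<in> Ds A"
    hence c: "u \<in> carrier A" "v \<in> carrier A"
      by (auto simp: Ds_def)
    have "rl_le A d u \<and> rl_le A d v" if "d \<in> Ds A" "rl_le A d (u \<otimes> v)" for d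
      using that c le_trans[of d "u \<otimes> v"] mult_le_left[of u v] mult_le_right[of u v]
      by (auto simp: Ds_def)
    thus "\<exists>w\<in>Ds A. principal {d \<in> Ds A. rl_le A d w} \<le>
        inf (principal {d \<in> Ds A. rl_le A d u}) (principal {d \<in> Ds A. rl_le A d v})"
      by (intro bexI[of _ "u \<otimes> v"]) (auto simp: Ds_mult uv)
  qed
  thus ?thesis
    by (simp add: eventually_principal imp_conjL Ball_def)
qed

lemma absolute_retract_least_dense:
  fixes A :: "'a rl"
  assumes "absolute_retract TYPE('a univ) E A"
  obtains e where "e \<in> Ds A" "\<And>x. x \<in> Ds A \<Longrightarrow> rl_le A e x"
proof -
  have A: "A \<in> rl_variety E"
    using assms by (simp add: absolute_retract_def)
  define q where "q = reduced_class A (lower_sections A)"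
  have rl: "residuated_lattice A"
    using A by (simp add: rl_variety_def)
  interpret reduced_power A "lower_sections A" q
    unfolding q_def using rl by (rule reduced_power_class)
  interpret B: residuated_lattice B
    by (rule residuated_lattice_B)
  \<comment> \<open>Each lower section contains its own generator \<open>u\<close>, hence is
    nonempty.\<close>
  have "lower_sections A \<noteq> bot"
    by (auto simp: trivial_limit_def eventually_lower_sections Ds_def intro: le_refl)
  then obtain r where r: "r \<in> rl_hom B A" "\<And>x. x \<in> carrier A \<Longrightarrow> r (q (\<lambda>_. x)) = x"
    using assms variety_B[OF A] diagonal_hom diagonal_inj
    unfolding absolute_retract_def by blast
  \<comment> \<open>The identity family, with value \<open>\<one>\<close> off the carrier to keep it
    in the power; those indices are negligible.\<close>
  define e where "e d = (if d \<in> carrier A then d else \<one>\<^bsub>A\<^esub>)" for d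
  have e: "e \<in> P"
    by (simp add: power_carrier_def e_def)
  \<comment> \<open>The section of \<open>\<one>\<close> is a witness, as it consists of dense
    indices.\<close>
  have "eventually (\<lambda>d. e d \<rightharpoonup>\<^bsub>A\<^esub> \<zero>\<^bsub>A\<^esub> = \<zero>\<^bsub>A\<^esub>) (lower_sections A)"
    unfolding eventually_lower_sections
    using one_dense by (auto simp: e_def Ds_def rl_neg_def)
  hence "q e \<in> Ds B"
    using e by (simp add: Ds_def rl_neg_def carrier_B zero_B ops_B q_eq_iff P_closed)
  hence "r (q e) \<in> Ds A"
    by (rule rl_hom_Ds[OF r(1) _ B.zero_closed])
  moreover have "rl_le A (r (q e)) x" if x: "x \<in> Ds A" for x
  proof -
    have c: "x \<in> carrier A"
      using x by (simp add: Ds_def)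
    \<comment> \<open>Here the witness is the section of \<open>x\<close> itself, on which
      \<open>e d = d\<close> lies below \<open>x\<close>.\<close>
    have "eventually (\<lambda>d. rl_le A (e d) x) (lower_sections A)"
      unfolding eventually_lower_sections using x by (auto simp: e_def Ds_def)
    hence "rl_le B (q e) (q (\<lambda>_. x))"
      using e c by (simp add: le_B diagonal_P)
    hence "rl_le A (r (q e)) (r (q (\<lambda>_. x)))"
      using rl_hom_le[OF r(1)] e c by (simp add: carrier_B diagonal_P)
    thus ?thesis
      using r(2) c by simp
  qed
  ultimately show ?thesis
    by (rule that)
qed

theorem theorem4p9:
  fixes A :: "'a rl" and E :: "(rl_term \<times> rl_term) set"
  assumes "radical_dense TYPE('a univ) E"
    and "absolute_retract TYPE('a univ) E A"
    and "\<not> semisimple A"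
  shows "\<exists>\<epsilon>. principal_unity A \<epsilon> \<and>
           subalgebra {\<zero>\<^bsub>A\<^esub>, \<epsilon>, \<one>\<^bsub>A\<^esub>} A \<and>
           rl_isomorphic (A\<lparr>carrier := {\<zero>\<^bsub>A\<^esub>, \<epsilon>, \<one>\<^bsub>A\<^esub>}\<rparr>) H3"
proof -
  have A: "A \<in> rl_variety E"
    using assms(2) by (simp add: absolute_retract_def)
  interpret residuated_lattice A
    using A by (simp add: rl_variety_def)
  have Rad: "Rad A = Ds A"
    using assms(1) A by (rule radical_dense_Rad_eq_Ds)
  obtain e where e: "e \<in> Ds A" and least: "\<And>x. x \<in> Ds A \<Longrightarrow> rl_le A e x"
    using absolute_retract_least_dense[OF assms(2)] by blast
  have c: "e \<in> carrier A" and neg: "e \<rightharpoonup>\<^bsub>A\<^esub> \<zero>\<^bsub>A\<^esub> = \<zero>\<^bsub>A\<^esub>"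
    using e by (auto simp: Ds_def rl_neg_def)
  have "\<exists>x\<in>Ds A. x \<noteq> \<one>\<^bsub>A\<^esub>"
    using assms(3) one_dense by (auto simp: semisimple_def Rad)
  \<comment> \<open>If the least dense element were \<open>\<one>\<close>, every dense element would
    be \<open>\<one>\<close>.\<close>
  hence "e \<noteq> \<one>\<^bsub>A\<^esub>"
    using least one_le_iff by (auto simp: Ds_def)
  moreover have "\<zero>\<^bsub>A\<^esub> \<noteq> \<one>\<^bsub>A\<^esub>"
    using \<open>e \<noteq> \<one>\<^bsub>A\<^esub>\<close> c zero_least[of e] one_le_iff[of e] by auto
  \<comment> \<open>The negation of \<open>\<zero>\<close> is \<open>\<one>\<close>, so
    \<open>\<zero>\<close> is not dense in a nontrivial algebra.\<close>
  moreover have "e \<noteq> \<zero>\<^bsub>A\<^esub>"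
    using neg \<open>\<zero>\<^bsub>A\<^esub> \<noteq> \<one>\<^bsub>A\<^esub>\<close> impl_eq_one_iff[of "\<zero>\<^bsub>A\<^esub>" "\<zero>\<^bsub>A\<^esub>"]
    by (auto simp: zero_closed le_refl)
  moreover have "e \<otimes>\<^bsub>A\<^esub> e = e"
    using e least by (rule least_dense_idem)
  ultimately have "subalgebra {\<zero>\<^bsub>A\<^esub>, e, \<one>\<^bsub>A\<^esub>} A"
      "rl_isomorphic (A\<lparr>carrier := {\<zero>\<^bsub>A\<^esub>, e, \<one>\<^bsub>A\<^esub>}\<rparr>) H3"
    using rl_isomorphic_H3[OF c] neg by auto
  moreover have "principal_unity A e"
    using e least by (simp add: principal_unity_def Rad)
  ultimately show ?thesis
    by blast
qed

end
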